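(* There is no (continuous) equivariant map $g:(SO(3),\rho_{S_4})\to(S^2,\tau_{S_4})$, where $\rho_{S_4}$ is the action of the symmetric group $S_4$ on $SO(3)$ given by multiplication from the right by the group of rotations of the cube $S_4\subset SO(3)$, and $\tau_{S_4}$ is the action of $S_4$ on $S^2$ given by the symmetry group of a regular tetrahedron inscribed in $S^2$.
   Context: Let $w_1,w_2,w_3,w_4\in S^2$ be the vertices of a regular tetrahedron inscribed in the unit sphere $S^2\subset\mathbb{R}^3$. For $\sigma\in S_4$ let $\tau(\sigma)\in O(3)$ be the unique orthogonal map with $\tau(\sigma)w_i=w_{\sigma(i)}$ for all $i$; this gives the action $\tau_{S_4}$ on $S^2$. The points $\pm w_1,\dots,\pm w_4$ are the vertices of a cube, and the rotation group of this cube is identified with $S_4$ via its action on the four diagonals; explicitly the embedding $\iota:S_4\to SO(3)$ is $\iota(\sigma)=\operatorname{sign}(\sigma)\,\tau(\sigma)$. The action $\rho_{S_4}$ on $SO(3)$ is by right multiplication; as a left action, $\rho_{S_4}(\sigma)A=A\,\iota(\sigma)^{-1}$. A map $g:SO(3)\to S^2$ is equivariant if it is continuous and $g(\rho_{S_4}(\sigma)A)=\tau(\sigma)g(A)$ for all $\sigma\in S_4$, $A\in SO(3)$. *)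

theory Defs
  imports "HOL-Analysis.Analysis"
begin

definition SO3 :: "(real ^ 3 ^ 3) set" where
  "SO3 = {A. rotation_matrix A}"

text \<open>In three-space, four points at equal positive mutual distances are the
  vertices of a regular tetrahedron.\<close>

definition inscribed_regular_tetrahedron :: "(4 \<Rightarrow> real ^ 3) \<Rightarrow> bool" where
  "inscribed_regular_tetrahedron w \<longleftrightarrow>
     (\<forall>i. w i \<in> sphere 0 1) \<and>
     (\<exists>d>0. \<forall>i j. i \<noteq> j \<longrightarrow> dist (w i) (w j) = d)"

text \<open>The group \<open>S\<^sub>4\<close> is rendered as the permutations of the four-element type \<open>4\<close>.\<close>

definition tau :: "(4 \<Rightarrow> real ^ 3) \<Rightarrow> (4 \<Rightarrow> 4) \<Rightarrow> real ^ 3 ^ 3" where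
  "tau w \<sigma> = (THE T. orthogonal_matrix T \<and> (\<forall>i. T *v w i = w (\<sigma> i)))"

definition iota :: "(4 \<Rightarrow> real ^ 3) \<Rightarrow> (4 \<Rightarrow> 4) \<Rightarrow> real ^ 3 ^ 3" where
  "iota w \<sigma> = of_int (sign \<sigma>) *\<^sub>R tau w \<sigma>"

definition rho :: "(4 \<Rightarrow> real ^ 3) \<Rightarrow> (4 \<Rightarrow> 4) \<Rightarrow> real ^ 3 ^ 3 \<Rightarrow> real ^ 3 ^ 3" where
  "rho w \<sigma> A = A ** matrix_inv (iota w \<sigma>)"

definition equivariant_map :: "(4 \<Rightarrow> real ^ 3) \<Rightarrow> (real ^ 3 ^ 3 \<Rightarrow> real ^ 3) \<Rightarrow> bool" where
  "equivariant_map w g \<longleftrightarrow>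
     g \<in> SO3 \<rightarrow> sphere 0 1 \<and> continuous_on SO3 g \<and>
     (\<forall>\<sigma>. \<sigma> permutes UNIV \<longrightarrow> (\<forall>A\<in>SO3. g (rho w \<sigma> A) = tau w \<sigma> *v g A))"

text \<open>The definite description in \<open>tau\<close> is well-defined, \<open>iota\<close> takes values
  in \<open>SO3\<close>, and inscribed regular tetrahedra exist.\<close>

lemma inner_w:
  assumes "inscribed_regular_tetrahedron w"
  shows "w i \<bullet> w j = (if i = j then 1 else -1/3)"
proof -
  obtain d where d: "d > 0" "\<And>i j. i \<noteq> j \<Longrightarrow> dist (w i) (w j) = d"
    using assms by (auto simp: inscribed_regular_tetrahedron_def)
  have n: "w i \<bullet> w i = 1" for i
    using assms by (auto simp: inscribed_regular_tetrahedron_def dot_square_norm)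
  define c where "c = 1 - d^2/2"
  have ip: "w i \<bullet> w j = (if i = j then 1 else c)" for i j
  proof (cases "i = j")
    case False
    have "d^2 = (w i - w j) \<bullet> (w i - w j)"
      using d(2)[OF False] by (simp add: dist_norm dot_square_norm)
    also have "\<dots> = 2 - 2 * (w i \<bullet> w j)"
      using n[of i] n[of j] by (simp add: algebra_simps inner_commute)
    finally show ?thesis using False by (simp add: c_def field_simps)
  qed (simp add: n)
  have "c < 1" using d by (simp add: c_def)
  have inj: "inj w"
  proof (rule injI, rule ccontr)
    fix i j assume "w i = w j" "i \<noteq> j"
    then show False using d(1) d(2)[of i j] by simp
  qed
  have "card (range w) = 4" using inj by (simp add: card_image)
  then have "dependent (range w)"
    by (intro dependent_biggerset) auto
  then obtain u0 v where u0: "(\<Sum>v\<in>range w. u0 v *\<^sub>R v) = 0" "v \<in> range w" "u0 v \<noteq> 0"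
    by (auto simp: dependent_finite)
  define u where "u i = u0 (w i)" for i
  have z: "(\<Sum>i\<in>UNIV. u i *\<^sub>R w i) = 0"
    using u0(1) inj by (simp add: sum.reindex u_def)
  have e: "(\<Sum>i\<in>UNIV. u i * (w i \<bullet> w j)) = 0" for j
    using arg_cong[OF z, of "\<lambda>x. x \<bullet> w j"] by (simp add: inner_sum_left)
  have nz: "u 1 \<noteq> 0 \<or> u 2 \<noteq> 0 \<or> u 3 \<noteq> 0 \<or> u 4 \<noteq> 0"
    using u0(2,3) exhaust_4 by (auto simp: u_def) metis
  have E: "(1-c) * u j + c * (u 1 + u 2 + u 3 + u 4) = 0" for j
    using e[of j] exhaust_4[of j] by (auto simp: sum_4 ip algebra_simps)
  have "(1-c) * u i = (1-c) * u j" for i j using E[of i] E[of j] by linarith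
  then have eq: "u i = u j" for i j using \<open>c < 1\<close> by simp
  then have "u 1 \<noteq> 0" using nz by metis
  moreover have "(1 + 3*c) * u 1 = 0"
    using E[of 1] eq[of 2 1] eq[of 3 1] eq[of 4 1] by (simp add: algebra_simps)
  ultimately have "c = -1/3" by simp
  then show ?thesis by (simp add: ip)
qed

lemma span_w:
  assumes "inscribed_regular_tetrahedron w"
  shows "span (range w) = UNIV"
proof -
  note ip = inner_w[OF assms]
  have d: "w 1 \<noteq> w 2" "w 1 \<noteq> w 3" "w 2 \<noteq> w 3"
    using ip[of 1 2] ip[of 1 3] ip[of 2 3] ip[of 1 1] ip[of 2 2] by auto
  have "independent {w 1, w 2, w 3}"
  proof -
    { fix a b c :: real assume z: "a *\<^sub>R w 1 + (b *\<^sub>R w 2 + c *\<^sub>R w 3) = 0"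
      have "a - b/3 - c/3 = 0"
        using arg_cong[OF z, of "\<lambda>x. x \<bullet> w 1"] by (simp add: inner_add_left ip)
      moreover have "b - a/3 - c/3 = 0"
        using arg_cong[OF z, of "\<lambda>x. x \<bullet> w 2"] by (simp add: inner_add_left ip)
      moreover have "c - b/3 - a/3 = 0"
        using arg_cong[OF z, of "\<lambda>x. x \<bullet> w 3"] by (simp add: inner_add_left ip)
      ultimately have "a = 0 \<and> b = 0 \<and> c = 0" by linarith }
    note H = this
    show ?thesis
      unfolding dependent_finite[OF finite.intros(2)[OF finite.intros(2)[OF finite.intros(2)[OF finite.emptyI]]]]
      using d by (auto dest!: H)
  qed
  moreover have "card {w 1, w 2, w 3} = 3" using d by simp
  ultimately have "span {w 1, w 2, w 3} = UNIV"
    using card_ge_dim_independent[of "{w 1, w 2, w 3}" "UNIV::(real^3) set"] by auto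
  moreover have "span {w 1, w 2, w 3} \<subseteq> span (range w)" by (intro span_mono) auto
  ultimately show ?thesis by auto
qed

lemma matrix_eq_on_w:
  assumes "inscribed_regular_tetrahedron w" "\<And>i. A *v w i = B *v w i"
  shows "A = (B :: real ^ 3 ^ 3)"
proof -
  have "A *v x = B *v x" for x
    by (rule linear_eq_on_span[of "(*v) A" "(*v) B" "range w" x])
       (use assms span_w[OF assms(1)] in auto)
  then show ?thesis by (simp add: matrix_eq)
qed

lemma tau_ex1:
  assumes "inscribed_regular_tetrahedron w" "\<sigma> permutes UNIV"
  shows "\<exists>!T. orthogonal_matrix T \<and> (\<forall>i. T *v w i = w (\<sigma> i))"
proof -
  note ip = inner_w[OF assms(1)]
  have "(\<Sum>i\<in>UNIV. w i) \<bullet> (\<Sum>i\<in>UNIV. w i) = 0"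
    by (simp add: sum_4 inner_add_left inner_add_right ip)
  then have s0: "(\<Sum>i\<in>UNIV. w i) = 0" by simp
  define f where "f p x = (3/4) *\<^sub>R (\<Sum>i\<in>UNIV. (w i \<bullet> x) *\<^sub>R w (p i))" for p x
  have lin: "linear (f p)" for p
    unfolding f_def
    by (intro linearI) (simp_all add: inner_add_right scaleR_add_left sum.distrib scaleR_sum_right algebra_simps)
  have fw: "f p (w j) = w (p j)" if "p permutes UNIV" for p j
  proof -
    have "(\<Sum>i\<in>UNIV. w (p i)) = 0"
      using s0 sum.permute[OF that, of w] by (simp add: o_def)
    then have "(\<Sum>i\<in>UNIV - {j}. w (p i)) = - w (p j)"
      by (simp add: sum_diff1)
    then have "(\<Sum>i\<in>UNIV - {j}. (w i \<bullet> w j) *\<^sub>R w (p i)) = (1/3) *\<^sub>R w (p j)"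
      (is "?L = ?R")
    proof -
      assume *: "(\<Sum>i\<in>UNIV - {j}. w (p i)) = - w (p j)"
      have "?L = (\<Sum>i\<in>UNIV - {j}. (-1/3) *\<^sub>R w (p i))"
        by (intro sum.cong) (auto simp: ip)
      also have "\<dots> = (-1/3) *\<^sub>R (\<Sum>i\<in>UNIV - {j}. w (p i))"
        by (rule scaleR_sum_right[symmetric])
      finally show ?thesis using * by simp
    qed
    then have "(\<Sum>i\<in>UNIV. (w i \<bullet> w j) *\<^sub>R w (p i)) = w (p j) + (1/3) *\<^sub>R w (p j)"
      by (subst sum.remove[of _ j]) (auto simp: ip)
    then show ?thesis unfolding f_def by (simp add: scaleR_add_right flip: scaleR_add_left)
  qed
  have adj: "f \<sigma> x \<bullet> y = x \<bullet> f (inv \<sigma>) y" for x y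
    unfolding f_def
    by (simp add: inner_sum_left inner_sum_right)
       (subst sum.permute[OF permutes_inv[OF assms(2)]],
        simp add: permutes_inverses[OF assms(2)] inner_commute mult.commute)
  define T where "T = matrix (f \<sigma>)"
  have T: "T *v x = f \<sigma> x" for x by (simp add: T_def lin)
  have Tt: "transpose T *v y = f (inv \<sigma>) y" for y
  proof -
    have "x \<bullet> (transpose T *v y) = x \<bullet> f (inv \<sigma>) y" for x
      using adj[of x y] by (metis T dot_lmul_matrix inner_commute transpose_matrix_vector vector_transpose_matrix)
    then show ?thesis by (metis vector_eq_ldot)
  qed
  have "transpose T ** T = mat 1"
    by (rule matrix_eq_on_w[OF assms(1)])
       (simp del: transpose_matrix_vector add: T Tt fw[OF assms(2)] fw[OF permutes_inv[OF assms(2)]]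
         permutes_inverses[OF assms(2)] flip: matrix_vector_mul_assoc)
  then have "orthogonal_matrix T" by (simp add: orthogonal_matrix)
  then show ?thesis
    by (intro ex1I[of _ T]) (auto simp: T fw assms(2) intro!: matrix_eq_on_w[OF assms(1)])
qed

lemma tau:
  assumes "inscribed_regular_tetrahedron w" "\<sigma> permutes UNIV"
  shows "orthogonal_matrix (tau w \<sigma>)" "tau w \<sigma> *v w i = w (\<sigma> i)"
  using theI'[OF tau_ex1[OF assms]] by (auto simp: tau_def)

lemma det_tau:
  assumes "inscribed_regular_tetrahedron w" "\<sigma> permutes UNIV"
  shows "det (tau w \<sigma>) = of_int (sign \<sigma>)"
proof -
  note ip = inner_w[OF assms(1)]
  have id: "tau w id = mat 1"
    by (rule matrix_eq_on_w[OF assms(1)]) (simp add: tau[OF assms(1) permutes_id])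
  have comp: "tau w (p \<circ> q) = tau w p ** tau w q" if "p permutes UNIV" "q permutes UNIV" for p q
    by (rule matrix_eq_on_w[OF assms(1)])
       (simp add: tau[OF assms(1)] that permutes_compose flip: matrix_vector_mul_assoc)
  have sw: "det (tau w (Transposition.transpose a b)) = -1" if "a \<noteq> b" for a b
  proof (rule ccontr)
    assume ne: "det (tau w (Transposition.transpose a b)) \<noteq> -1"
    define T where "T = tau w (Transposition.transpose a b)"
    have p: "Transposition.transpose a b permutes UNIV" by (rule permutes_swap_id) auto
    have o: "orthogonal_matrix T" unfolding T_def by (rule tau[OF assms(1) p])
    have Tw: "T *v w i = w (Transposition.transpose a b i)" for i
      unfolding T_def by (rule tau[OF assms(1) p])
    have rot: "rotation_matrix T"
      using ne det_orthogonal_matrix[OF o] o by (auto simp: rotation_matrix_def T_def)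
    have "\<exists>c d. c \<noteq> d \<and> c \<notin> {a,b} \<and> d \<notin> {a,b} \<and> UNIV = {a,b,c,d}"
    proof -
      have "card (UNIV - {a,b}) = 2" using that by (simp add: card_Diff_subset)
      then obtain c d where cd: "UNIV - {a,b} = {c,d}" "c \<noteq> d" by (auto simp: card_2_iff)
      then have "UNIV = {a,b,c,d}" "c \<notin> {a,b}" "d \<notin> {a,b}" by auto
      with cd show ?thesis by blast
    qed
    then obtain c d where cd: "c \<noteq> d" "c \<noteq> a" "c \<noteq> b" "d \<noteq> a" "d \<noteq> b" "UNIV = {a,b,c,d}"
      by auto
    define n where "n = cross3 (w c) (w d)"
    have Tn: "T *v n = n"
      using cross_rotation_matrix[OF rot, of "w c" "w d"] cd
      by (simp add: n_def Tw transpose_apply_other)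
    have "(T *v n) \<bullet> (T *v w a) = n \<bullet> w a"
      using o by (simp add: orthogonal_matrix_def dot_lmul_matrix[symmetric] vector_transpose_matrix
            matrix_vector_mul_assoc flip: transpose_matrix_vector)
    then have 1: "n \<bullet> w b = n \<bullet> w a" by (simp add: Tn Tw)
    have 2: "n \<bullet> w c = 0" "n \<bullet> w d = 0" by (simp_all add: n_def dot_cross_self)
    have "(\<Sum>i\<in>UNIV. w i) \<bullet> (\<Sum>i\<in>UNIV. w i) = 0"
      by (simp add: sum_4 inner_add_left inner_add_right ip)
    then have "n \<bullet> (\<Sum>i\<in>UNIV. w i) = 0" by simp
    then have "n \<bullet> w a = 0" using that cd(1-5) 1 2
      unfolding cd(6) by (simp add: inner_add_right)
    then have all: "n \<bullet> w i = 0" for i using 1 2 cd(6) by (metis UNIV_I insertE singletonD)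
    have "n \<bullet> n = 0"
      using all span_w[OF assms(1)]
      by (metis (mono_tags, lifting) UNIV_I orthogonal_def orthogonal_to_span rangeE)
    then have "n = 0" by simp
    moreover have "(norm n)^2 = 1 - (1/3)^2"
      using norm_cross_dot[of "w c" "w d"] cd(1) ip[of c c] ip[of d d] ip[of c d]
      by (simp add: n_def norm_eq_sqrt_inner power2_eq_square)
    ultimately show False by (simp add: power2_eq_square)
  qed
  show ?thesis using assms(2) finite[of "UNIV :: 4 set"]
  proof (induction rule: permutes_induct)
    case id show ?case unfolding \<open>tau w id = mat 1\<close> by simp
  next
    case (swap a b p)
    have p: "Transposition.transpose a b permutes UNIV" by (rule permutes_swap_id) auto
    have "permutation (Transposition.transpose a b)" "permutation p"
      using p swap by (auto intro: permutes_imp_permutation[OF finite[of "UNIV :: 4 set"]])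
    then show ?case using swap
      unfolding comp[OF p \<open>p permutes UNIV\<close>] det_mul
      by (subst sign_compose) (auto simp: sw sign_swap_id)
  qed
qed

lemma iota_in_SO3:
  assumes "inscribed_regular_tetrahedron w" "\<sigma> permutes UNIV"
  shows "iota w \<sigma> \<in> SO3"
proof -
  have "orthogonal_matrix (iota w \<sigma>)"
    using tau(1)[OF assms]
    by (auto simp: iota_def sign_def orthogonal_matrix matrix_matrix_mult_def transpose_def vec_eq_iff)
  moreover have "det (iota w \<sigma>) = 1"
    using det_tau[OF assms] by (auto simp: iota_def sign_def det_3 algebra_simps split: if_splits)
  ultimately show ?thesis by (simp add: SO3_def rotation_matrix_def)
qed

lemma inscribed_regular_tetrahedron_exists: "\<exists>w. inscribed_regular_tetrahedron w"
proof
  show "inscribed_regular_tetrahedron (\<lambda>i. (1/sqrt 3) *\<^sub>R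
    (if i = 1 then vector [1,1,1] else if i = 2 then vector [1,-1,-1]
     else if i = 3 then vector [-1,1,-1] else vector [-1,-1,1]))"
    unfolding inscribed_regular_tetrahedron_def
    by (intro conjI exI[of _ "sqrt (8/3)"])
      (auto simp: forall_4 dist_norm norm_eq_sqrt_inner inner_vec_def sum_3 real_div_sqrt field_simps)
qed

end

theory Submission
  imports Defs
begin

text \<open>
  Both actions come from the same permutation \<open>\<sigma>\<close>, and \<open>iota\<close> and \<open>tau\<close> differ only by the sign of
  \<open>\<sigma>\<close>. If \<open>g\<close> is equivariant, then \<open>A \<mapsto> A g (A)\<close> is therefore invariant under even permutations
  and is negated by odd ones. Pulling it back along the double cover of \<open>SO(3)\<close> by the unit
  quaternions gives a continuous map \<open>f\<close> from the three-sphere to the two-sphere with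
  \<open>f (q c) = - f (q)\<close> whenever the unit quaternion \<open>c\<close> represents an odd element of the rotation
  group of the cube. Two odd elements lead to a contradiction: a transposition, that is, a half-turn,
  represented by some \<open>c\<close> with \<open>c\<^sup>2 = -1\<close>, and a four-cycle, that is, a quarter-turn, represented by
  some \<open>a\<close> with \<open>a\<^sup>4 = -1\<close>.

  The map \<open>f\<close> lifts through the Hopf map to a map \<open>k\<close> from the three-sphere to itself with
  \<open>f = k i k\<^sup>-\<^sup>1\<close> (\<open>hopf_lift_sphere\<close>), and two lifts of the same map differ by a phase
  \<open>exp (\<theta> i)\<close> with \<open>\<theta>\<close> real-valued and continuous (\<open>hopf_lift_phase\<close>). Since \<open>k j\<close> lifts \<open>- f\<close>,
  the oddness of \<open>f\<close> under \<open>c\<close> says that \<open>k (q c) = k (q) j exp (\<theta> (q) i)\<close> for some \<open>\<theta>\<close>, and similarly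
  for \<open>a\<close>. Iterating these two relations expresses the phase of \<open>k (-q)\<close> relative to \<open>k (q)\<close> in two
  ways. The sum of this real phase over \<open>q\<close> and \<open>-q\<close> is a constant multiple of \<open>2 \<pi>\<close> which is
  determined modulo \<open>4 \<pi>\<close> by \<open>k\<close>. Each factor \<open>j\<^sup>2 = -1\<close> contributes \<open>\<pi>\<close> to the phase and everything
  else cancels by symmetry, so the sum is \<open>2 \<pi>\<close> when computed from \<open>c\<close>, where one such factor
  occurs, and \<open>4 \<pi>\<close> when computed from \<open>a\<close>, where two occur (\<open>no_lift_odd_under_roots\<close>).
\<close>

section \<open>Quaternions\<close>

text \<open>Quaternions are stored as a scalar part together with a vector part. With this encoding the unit
  quaternions are a sphere in a Euclidean space, so that its topology is available at once, and the
  unit vectors of three-space are exactly the pure unit quaternions.\<close>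

type_synonym quat = "real \<times> (real ^ 3)"

definition qmul :: "quat \<Rightarrow> quat \<Rightarrow> quat" (infixl "\<odot>" 70)
  where "p \<odot> q = (fst p * fst q - snd p \<bullet> snd q,
    fst p *\<^sub>R snd q + fst q *\<^sub>R snd p + cross3 (snd p) (snd q))"

definition qconj :: "quat \<Rightarrow> quat"
  where "qconj p = (fst p, - snd p)"

lemma qmul_assoc: "(p \<odot> q) \<odot> r = p \<odot> (q \<odot> r)"
  by (simp add: qmul_def prod_eq_iff vec_eq_iff forall_3 inner_vec_def sum_3 cross_components algebra_simps)

lemma norm_qmul: "norm (p \<odot> q) = norm p * norm q"
proof -
  have "(norm (p \<odot> q))\<^sup>2 = (norm p * norm q)\<^sup>2"
    unfolding power_mult_distrib power2_norm_eq_inner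
    by (simp add: qmul_def inner_prod_def inner_vec_def sum_3 cross_components power2_eq_square algebra_simps)
  then show ?thesis by simp
qed

interpretation qmul: bounded_bilinear qmul
proof
  show "\<exists>K. \<forall>a b. norm (a \<odot> b) \<le> norm a * norm b * K"
    by (rule exI[of _ 1]) (simp add: norm_qmul)
qed (simp_all add: qmul_def prod_eq_iff inner_add_left inner_add_right cross_add_left cross_add_right
      cross_mult_left cross_mult_right algebra_simps)

lemma qmul_one [simp]: "(1, 0) \<odot> q = q" "q \<odot> (1, 0) = q"
  by (simp_all add: qmul_def)

lemma qmul_neg_one [simp]: "(-1, 0) \<odot> q = - q" "q \<odot> (-1, 0) = - q"
  by (simp_all add: qmul_def prod_eq_iff)

lemma qmul_qconj: "q \<odot> qconj q = ((norm q)\<^sup>2, 0)" "qconj q \<odot> q = ((norm q)\<^sup>2, 0)"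
  unfolding power2_norm_eq_inner
  by (simp_all add: qmul_def qconj_def inner_prod_def)

lemma qmul_qconj_unit: "norm q = 1 \<Longrightarrow> q \<odot> qconj q = (1, 0)" "norm q = 1 \<Longrightarrow> qconj q \<odot> q = (1, 0)"
  by (simp_all add: qmul_qconj)

lemma norm_qconj [simp]: "norm (qconj q) = norm q"
  by (simp add: qconj_def norm_prod_def)

lemma qconj_qmul: "qconj (p \<odot> q) = qconj q \<odot> qconj p"
  by (simp add: qmul_def qconj_def cross_skew[of "snd q"] inner_commute)

lemma pure_unit_square: "norm v = 1 \<Longrightarrow> (0, v) \<odot> (0, v) = (-1, 0)"
  by (simp add: qmul_def dot_square_norm)

lemma norm_axis_real [simp]: "norm (axis k t :: real ^ 'n) = \<bar>t\<bar>"
proof -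
  have "axis k t = t *\<^sub>R (axis k 1 :: real ^ 'n)" by (simp add: vec_eq_iff axis_def)
  then show ?thesis by simp
qed

abbreviation qi where "qi \<equiv> (0::real, axis 1 1 :: real ^ 3)"
abbreviation qj where "qj \<equiv> (0::real, axis 2 1 :: real ^ 3)"

text \<open>Euler's formula for the imaginary unit \<open>i\<close>: the circle subgroup \<open>exp (t i)\<close>.\<close>

definition cis_i :: "real \<Rightarrow> quat" where "cis_i t = (cos t, axis 1 (sin t))"

lemma cis_i_add: "cis_i (s + t) = cis_i s \<odot> cis_i t"
  by (simp add: cis_i_def qmul_def prod_eq_iff vec_eq_iff forall_3 axis_def inner_vec_def sum_3 cross_components cos_add sin_add)

lemma cis_i_qi: "cis_i t \<odot> qi = qi \<odot> cis_i t"
  by (simp add: cis_i_def qmul_def prod_eq_iff vec_eq_iff forall_3 axis_def inner_vec_def sum_3 cross_components)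

text \<open>Conjugation by \<open>j\<close> inverts the circle subgroup. This sign is what later turns the phase of a
  square into a difference instead of a sum.\<close>

lemma cis_i_qj: "cis_i t \<odot> qj = qj \<odot> cis_i (- t)"
  by (simp add: cis_i_def qmul_def prod_eq_iff vec_eq_iff forall_3 axis_def inner_vec_def sum_3 cross_components)

lemma qi_qj: "qi \<odot> qj = - (qj \<odot> qi)"
  by (simp add: qmul_def prod_eq_iff vec_eq_iff forall_3 axis_def inner_vec_def sum_3 cross_components)

lemma cis_i_zero: "cis_i 0 = (1, 0)"
  by (simp add: cis_i_def vec_eq_iff axis_def)

lemma cis_i_pi: "cis_i pi = (-1, 0)"
  by (simp add: cis_i_def prod_eq_iff vec_eq_iff axis_def)

lemma norm_cis_i [simp]: "norm (cis_i t) = 1"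
  by (simp add: cis_i_def norm_prod_def)

lemma cis_i_eq_iff: "cis_i s = cis_i t \<longleftrightarrow> (\<exists>n::int. s = t + 2 * pi * n)"
  unfolding sin_cos_eq_iff[symmetric]
  by (auto simp: cis_i_def axis_eq_axis)

text \<open>The centraliser of \<open>i\<close> is the plane of complex numbers spanned by \<open>1\<close> and \<open>i\<close>.\<close>

lemma commutes_with_qi:
  assumes "d \<odot> qi = qi \<odot> d"
  shows "d = (fst d, axis 1 (snd d $ 1))"
  using assms
  by (simp add: qmul_def prod_eq_iff vec_eq_iff forall_3 axis_def inner_vec_def sum_3 cross_components)

lemma continuous_on_cis_i [continuous_intros]:
  fixes f :: "'a::topological_space \<Rightarrow> real"
  assumes "continuous_on S f" shows "continuous_on S (\<lambda>x. cis_i (f x))"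
proof -
  have "cis_i t = (cos t, sin t *\<^sub>R axis 1 1)" for t
    by (simp add: cis_i_def prod_eq_iff vec_eq_iff axis_def)
  moreover have "continuous_on S (\<lambda>x. cos (f x))" "continuous_on S (\<lambda>x. sin (f x))"
    using continuous_on_compose2[OF _ assms, of UNIV cos] continuous_on_compose2[OF _ assms, of UNIV sin]
    by (auto simp: continuous_at_imp_continuous_on)
  ultimately show ?thesis by (auto intro!: continuous_intros)
qed

lemma continuous_on_qconj [continuous_intros]:
  "continuous_on S f \<Longrightarrow> continuous_on S (\<lambda>x. qconj (f x))"
  unfolding qconj_def by (intro continuous_intros)

lemmas continuous_on_qmul [continuous_intros] = qmul.continuous_on

section \<open>Lifts through the Hopf map\<close>

text \<open>The Hopf map sends a unit quaternion \<open>k\<close> to the unit vector \<open>k i k\<^sup>-\<^sup>1\<close>. A lift of \<open>f\<close> along it is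
  described by the equation \<open>f k = k i\<close> instead of \<open>f = k i k\<^sup>-\<^sup>1\<close>, because this form is linear in \<open>k\<close>.\<close>

definition hopf_lift :: "'a::topological_space set \<Rightarrow> ('a \<Rightarrow> real ^ 3) \<Rightarrow> ('a \<Rightarrow> quat) \<Rightarrow> bool" where
  "hopf_lift S f k \<longleftrightarrow> continuous_on S k \<and> (\<forall>x\<in>S. norm (k x) = 1 \<and> (0, f x) \<odot> k x = k x \<odot> qi)"

text \<open>The quotient \<open>k\<^sup>-\<^sup>1 k'\<close> of two lifts commutes with \<open>i\<close>, so it takes values in the circle
  subgroup; on a Borsukian set a circle-valued map has a continuous real logarithm.\<close>

lemma hopf_lift_phase:
  fixes S :: "'a::real_normed_vector set"
  assumes S: "Borsukian S" and k: "hopf_lift S f k" and k': "hopf_lift S f k'"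
  obtains \<theta> where "continuous_on S \<theta>" "\<And>x. x \<in> S \<Longrightarrow> k' x = k x \<odot> cis_i (\<theta> x)"
proof -
  define d where "d x = qconj (k x) \<odot> k' x" for x
  have k'd: "k' x = k x \<odot> d x" if "x \<in> S" for x
    using that k by (simp add: d_def hopf_lift_def qmul_qconj_unit flip: qmul_assoc)
  have d: "d x = (fst (d x), axis 1 (snd (d x) $ 1))" if x: "x \<in> S" for x
  proof (rule commutes_with_qi)
    have n: "norm (k x) = 1" and fk: "(0, f x) \<odot> k x = k x \<odot> qi" and fk': "(0, f x) \<odot> k' x = k' x \<odot> qi"
      using k k' x by (auto simp: hopf_lift_def)
    have "qconj (k x) \<odot> (0, f x) = qconj (k x) \<odot> ((0, f x) \<odot> k x) \<odot> qconj (k x)"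
      by (simp add: qmul_assoc qmul_qconj_unit n)
    also have "\<dots> = qi \<odot> qconj (k x)"
      unfolding fk by (simp add: qmul_qconj_unit n flip: qmul_assoc)
    finally have *: "qconj (k x) \<odot> (0, f x) = qi \<odot> qconj (k x)" .
    show "d x \<odot> qi = qi \<odot> d x"
      unfolding d_def qmul_assoc fk'[symmetric] unfolding qmul_assoc[symmetric] * ..
  qed
  have nd: "norm (d x) = 1" if "x \<in> S" for x
    using that k k' by (simp add: d_def norm_qmul hopf_lift_def)
  define z where "z x = Complex (fst (d x)) (snd (d x) $ 1)" for x
  have contd: "continuous_on S d"
    using k k' unfolding d_def hopf_lift_def by (auto intro!: continuous_intros)
  have "continuous_on S z"
    unfolding z_def Complex_eq by (intro continuous_intros contd)
  moreover have "cmod (z x) = 1" if "x \<in> S" for x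
    using nd[OF that] d[OF that] by (metis z_def norm_prod_def norm_axis_real complex_norm complex.sel power2_abs real_norm_def fst_conv snd_conv)
  ultimately obtain \<theta> where \<theta>: "continuous_on S (complex_of_real \<circ> \<theta>)" "\<And>x. x \<in> S \<Longrightarrow> z x = exp (\<i> * of_real (\<theta> x))"
    using S unfolding Borsukian_continuous_logarithm_circle_real by (force simp: Pi_iff)
  have "continuous_on S \<theta>" using continuous_on_Re[OF \<theta>(1)] by (simp add: o_def)
  moreover have "k' x = k x \<odot> cis_i (\<theta> x)" if "x \<in> S" for x
  proof -
    have "Complex (fst (d x)) (snd (d x) $ 1) = Complex (cos (\<theta> x)) (sin (\<theta> x))"
      using \<theta>(2)[OF that] by (simp add: z_def complex_eq_iff flip: cis_conv_exp)
    then show ?thesis using d[OF that] k'd[OF that] by (simp add: cis_i_def)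
  qed
  ultimately show thesis by (rule that)
qed

text \<open>A lift can be transported to any map \<open>f'\<close> that is never antipodal to \<open>f\<close>. For every \<open>k\<close> the
  quaternion \<open>m = k - f' k i\<close> solves \<open>f' m = m i\<close>, since both \<open>f'\<close> and \<open>i\<close> square to \<open>-1\<close>;
  if \<open>f k = k i\<close> and \<open>m = 0\<close>, then \<open>(f - f') k i = -2 k\<close>, which forces \<open>f\<close> and \<open>f'\<close> to be at
  distance two.\<close>

lemma hopf_lift_step:
  assumes k: "hopf_lift S f k" and f': "continuous_on S f'" "\<And>x. x \<in> S \<Longrightarrow> norm (f' x) = 1"
    and close: "\<And>x. x \<in> S \<Longrightarrow> norm (f x - f' x) < 2"
  shows "\<exists>k'. hopf_lift S f' k'"
proof -
  \<comment> \<open>Up to normalisation, \<open>m\<close> is the projection of \<open>k\<close> onto the solutions of \<open>f' m = m i\<close>.\<close>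
  define m where "m x = k x - (0, f' x) \<odot> (k x \<odot> qi)" for x
  have mcont: "continuous_on S m"
    using k f' unfolding m_def hopf_lift_def by (auto intro!: continuous_intros)
  have nz: "m x \<noteq> 0" if x: "x \<in> S" for x
  proof
    assume "m x = 0"
    have n: "norm (k x) = 1" and fk: "(0, f x) \<odot> k x = k x \<odot> qi" using k x by (auto simp: hopf_lift_def)
    have "(0, f x - f' x) \<odot> (k x \<odot> qi) = (0, f x) \<odot> (k x \<odot> qi) - (0, f' x) \<odot> (k x \<odot> qi)"
      by (simp flip: qmul.diff_left)
    also have "(0, f x) \<odot> (k x \<odot> qi) = - k x"
      unfolding qmul_assoc[symmetric] fk unfolding qmul_assoc by (simp add: pure_unit_square)
    also have "(0, f' x) \<odot> (k x \<odot> qi) = k x" using \<open>m x = 0\<close> by (simp add: m_def)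
    finally have "norm ((0::real, f x - f' x) \<odot> (k x \<odot> qi)) = norm (- k x - k x)" by simp
    then have "norm (f x - f' x) = norm (- k x - k x)"
      unfolding norm_qmul n by (simp add: norm_Pair)
    also have "- k x - k x = - (2 *\<^sub>R k x)" by (simp add: scaleR_2)
    finally show False using close[OF x] n by simp
  qed
  have eq: "(0, f' x) \<odot> m x = m x \<odot> qi" if x: "x \<in> S" for x
    using f'(2)[OF x] unfolding m_def qmul.diff_right qmul.diff_left
    by (simp add: pure_unit_square qmul_assoc qmul.minus_right)
      (simp add: pure_unit_square qmul.minus_left flip: qmul_assoc)
  have "hopf_lift S f' (\<lambda>x. (1 / norm (m x)) *\<^sub>R m x)"
    unfolding hopf_lift_def
    using nz eq by (auto intro!: continuous_intros mcont simp: qmul.scaleR_right qmul.scaleR_left)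
  then show ?thesis by blast
qed

text \<open>For every unit vector \<open>v\<close> the quaternion \<open>1 - v i\<close> solves the equation; it vanishes exactly at
  \<open>v = -i\<close>, and there \<open>j\<close> is a solution.\<close>

lemma hopf_lift_point:
  assumes "norm v = 1"
  obtains q where "norm q = 1" "(0, v) \<odot> q = q \<odot> qi"
proof (cases "(0, v) \<odot> qi = (1, 0)")
  case True
  have "(0, v) = - ((0, v) \<odot> qi \<odot> qi)"
    by (simp add: qmul_assoc pure_unit_square)
  then have v: "(0, v) = - qi" unfolding True by simp
  show thesis
  proof (rule that[of qj])
    show "(0, v) \<odot> qj = qj \<odot> qi" unfolding v qmul.minus_left qi_qj by simp
  qed (simp add: norm_Pair)
next
  case False
  define m where "m = (1, 0) - (0, v) \<odot> qi"
  have "(0, v) \<odot> m = m \<odot> qi"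
    unfolding m_def qmul.diff_right qmul.diff_left
    by (simp add: pure_unit_square qmul_assoc)(simp add: pure_unit_square assms flip: qmul_assoc)
  moreover have "m \<noteq> 0" using False by (simp add: m_def)
  ultimately show thesis
    by (intro that[of "(1 / norm m) *\<^sub>R m"]) (simp_all add: qmul.scaleR_right qmul.scaleR_left)
qed

text \<open>Contracting the domain to the origin deforms \<open>f\<close> into a constant map. By uniform continuity this
  deformation can be cut into finitely many steps during which no value moves by two or more, and
  the lift of the constant map is transported through them.\<close>

lemma hopf_lift_convex:
  fixes B :: "'a::real_normed_vector set"
  assumes B: "compact B" "convex B" "0 \<in> B"
    and f: "continuous_on B f" "\<And>x. x \<in> B \<Longrightarrow> norm (f x) = 1"
  obtains k where "hopf_lift B f k"
proof -
  obtain d where d: "d > 0" "\<And>x y. x \<in> B \<Longrightarrow> y \<in> B \<Longrightarrow> dist x y < d \<Longrightarrow> dist (f x) (f y) < 2"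
    using compact_uniformly_continuous[OF f(1) B(1)]
    unfolding uniformly_continuous_on_def by (metis zero_less_numeral)
  obtain M where M: "M > 0" "\<And>x. x \<in> B \<Longrightarrow> norm x \<le> M"
    using compact_imp_bounded[OF B(1)] by (auto simp: bounded_pos)
  obtain N :: nat where N: "M / d < real N" using reals_Archimedean2 by blast
  have "0 < M / d" using M d by simp
  then have N0: "real N > 0" using N by linarith
  have inB: "t *\<^sub>R x \<in> B" if "x \<in> B" "0 \<le> t" "t \<le> 1" for x t
    using convexD_alt[OF B(2,3) that(1,2,3)] by simp
  have cont: "continuous_on B (\<lambda>x. f (t *\<^sub>R x))" if "0 \<le> t" "t \<le> 1" for t
    by (rule continuous_on_compose2[OF f(1)]) (use inB that in \<open>auto intro!: continuous_intros\<close>)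
  have "\<exists>k. hopf_lift B (\<lambda>x. f ((real i / real N) *\<^sub>R x)) k" if "i \<le> N" for i
    using that
  proof (induction i)
    case 0
    obtain q where "norm q = 1" "(0, f 0) \<odot> q = q \<odot> qi" using hopf_lift_point f(2) B(3) by blast
    then have "hopf_lift B (\<lambda>x. f ((real 0 / real N) *\<^sub>R x)) (\<lambda>x. q)"
      by (simp add: hopf_lift_def)
    then show ?case by blast
  next
    case (Suc i)
    then obtain k where k: "hopf_lift B (\<lambda>x. f ((real i / real N) *\<^sub>R x)) k" by auto
    have t: "0 \<le> real i / real N" "real i / real N \<le> 1" "0 \<le> real (Suc i) / real N" "real (Suc i) / real N \<le> 1"
      using Suc.prems N0 by auto
    show ?case
    proof (rule hopf_lift_step[OF k cont[OF t(3,4)]])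
      fix x assume x: "x \<in> B"
      show "norm (f ((real (Suc i) / real N) *\<^sub>R x)) = 1" using f(2) inB[OF x t(3,4)] by simp
      have "dist ((real i / real N) *\<^sub>R x) ((real (Suc i) / real N) *\<^sub>R x) = norm x / real N"
        unfolding dist_norm scaleR_diff_left[symmetric] by (simp add: diff_divide_distrib[symmetric] N0)
      also have "\<dots> \<le> M / real N" using M(2)[OF x] N0 by (simp add: divide_right_mono)
      also have "\<dots> < d" using N N0 d(1) by (simp add: field_simps)
      finally show "norm (f ((real i / real N) *\<^sub>R x) - f ((real (Suc i) / real N) *\<^sub>R x)) < 2"
        using d(2)[OF inB[OF x t(1,2)] inB[OF x t(3,4)]] by (simp add: dist_norm)
    qed
  qed
  from this[of N] show thesis using N0 that by auto
qed

lemma hopf_lift_compose: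
  assumes "hopf_lift T f k" "continuous_on S p" "p \<in> S \<rightarrow> T"
  shows "hopf_lift S (\<lambda>x. f (p x)) (\<lambda>x. k (p x))"
  using assms unfolding hopf_lift_def
  by (auto intro: continuous_on_compose2[of T k S p])

lemma hopf_lift_cong:
  assumes "hopf_lift S f k" "\<And>x. x \<in> S \<Longrightarrow> f x = g x"
  shows "hopf_lift S g k"
  using assms by (simp add: hopf_lift_def)

lemma Borsukian_sphere:
  fixes a :: "'a::euclidean_space"
  assumes "3 \<le> DIM('a)" shows "Borsukian (sphere a r)"
  by (intro simply_connected_imp_Borsukian simply_connected_sphere locally_path_connected_sphere assms)

lemma hopf_lift_cis_i:
  assumes "hopf_lift S f k" "continuous_on S \<theta>"
  shows "hopf_lift S f (\<lambda>x. k x \<odot> cis_i (\<theta> x))"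
  using assms unfolding hopf_lift_def
  by (auto intro!: continuous_intros simp: norm_qmul qmul_assoc cis_i_qi)(simp flip: qmul_assoc)

text \<open>The two closed hemispheres are graphs over a ball of dimension three, so \<open>f\<close> lifts over each. The
  two lifts differ over the equator, a two-sphere, by a phase with a continuous real logarithm;
  extending that logarithm to the whole space corrects one lift so that it agrees with the other.\<close>

lemma hopf_lift_sphere:
  fixes f :: "quat \<Rightarrow> real ^ 3"
  assumes f: "continuous_on (sphere 0 1) f" "\<And>q. q \<in> sphere 0 1 \<Longrightarrow> norm (f q) = 1"
  obtains k where "hopf_lift (sphere 0 1) f k"
proof -
  \<comment> \<open>The factor \<open>s\<close> is \<open>1\<close> for the upper and \<open>-1\<close> for the lower hemisphere.\<close>
  define H where "H s = {q::quat. q \<in> sphere 0 1 \<and> s * fst q \<ge> 0}" for s :: real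
  have lift: "\<exists>k. hopf_lift (H s) f k" if s: "s\<^sup>2 = 1" for s
  proof -
    let ?B = "cball 0 1 :: (real ^ 3) set"
    let ?p = "\<lambda>v::real^3. (s * sqrt (1 - (norm v)\<^sup>2), v)"
    have p: "?p v \<in> sphere 0 1" if "v \<in> ?B" for v
      using that s by (simp add: norm_Pair power_mult_distrib power_le_one)
    have "continuous_on ?B (\<lambda>v. f (?p v))"
      by (rule continuous_on_compose2[OF f(1)]) (use p in \<open>auto intro!: continuous_intros\<close>)
    then obtain k where k: "hopf_lift ?B (\<lambda>v. f (?p v)) k"
      using hopf_lift_convex[of ?B "\<lambda>v. f (?p v)"] f(2) p by auto
    have sn: "norm (snd q) \<le> 1" if "q \<in> H s" for q
      using that norm_snd_le[of "snd q" "fst q"] by (simp add: H_def)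
    have "?p (snd q) = q" if q: "q \<in> H s" for q
    proof -
      have "1 - (norm (snd q))\<^sup>2 = (fst q)\<^sup>2"
        using q by (auto simp: H_def norm_prod_def)
      also have "\<dots> = (s * fst q)\<^sup>2" using s by (simp add: power_mult_distrib)
      finally have "sqrt (1 - (norm (snd q))\<^sup>2) = s * fst q" using q by (simp add: H_def)
      then show ?thesis using s by (simp add: prod_eq_iff power2_eq_square flip: mult.assoc)
    qed
    then have "hopf_lift (H s) f (\<lambda>q. k (snd q))"
      by (intro hopf_lift_cong[OF hopf_lift_compose[OF k, of "H s" snd]])
        (use sn in \<open>auto intro!: continuous_intros\<close>)
    then show ?thesis by blast
  qed
  obtain k\<^sub>1 k\<^sub>2 where k\<^sub>1: "hopf_lift (H 1) f k\<^sub>1" and k\<^sub>2: "hopf_lift (H (-1)) f k\<^sub>2"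
    using lift[of 1] lift[of "-1"] by auto
  have clos: "closed (H s)" for s
  proof -
    have "H s = sphere 0 1 \<inter> {q. 0 \<le> s * fst q}" by (auto simp: H_def)
    then show ?thesis by (auto intro!: closed_Int closed_Collect_le continuous_intros)
  qed
  define E where "E = H 1 \<inter> H (-1)"
  have E: "E = (\<lambda>v. (0, v)) ` sphere (0::real^3) 1"
  proof (intro equalityI subsetI)
    fix q assume q: "q \<in> E"
    then have "fst q = 0" by (auto simp: E_def H_def)
    then have "q = (0, snd q)" by (simp add: prod_eq_iff)
    moreover have "norm q = norm (snd q)" using \<open>fst q = 0\<close> by (simp add: norm_prod_def)
    then have "norm (snd q) = 1" using q by (simp add: E_def H_def)
    ultimately show "q \<in> (\<lambda>v. (0, v)) ` sphere 0 1" by auto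
  qed (auto simp: E_def H_def)
  have "linear (\<lambda>v::real^3. (0::real, v))" by (auto intro!: linearI)
  moreover have "inj (\<lambda>v::real^3. (0::real, v))" by (auto intro!: injI)
  moreover have "Borsukian (sphere (0::real^3) 1)" by (rule Borsukian_sphere) simp
  ultimately have "Borsukian E"
    unfolding E using Borsukian_injective_linear_image by blast
  moreover have "hopf_lift E f k\<^sub>1" "hopf_lift E f k\<^sub>2"
    using k\<^sub>1 k\<^sub>2 unfolding hopf_lift_def E_def by (auto intro: continuous_on_subset)
  ultimately obtain \<theta> where \<theta>: "continuous_on E \<theta>" "\<And>x. x \<in> E \<Longrightarrow> k\<^sub>2 x = k\<^sub>1 x \<odot> cis_i (\<theta> x)"
    using hopf_lift_phase by metis
  obtain \<phi> where \<phi>: "continuous_on UNIV \<phi>" "\<And>x. x \<in> E \<Longrightarrow> \<phi> x = \<theta> x"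
    using Tietze_unbounded[OF \<theta>(1), of UNIV] clos by (auto simp: E_def)
  have k3: "hopf_lift (H 1) f (\<lambda>q. k\<^sub>1 q \<odot> cis_i (\<phi> q))"
    using hopf_lift_cis_i[OF k\<^sub>1] \<phi>(1) continuous_on_subset by blast
  define k where "k q = (if fst q \<ge> 0 then k\<^sub>1 q \<odot> cis_i (\<phi> q) else k\<^sub>2 q)" for q
  have S: "sphere 0 1 = H 1 \<union> H (-1)" by (auto simp: H_def)
  have "continuous_on (sphere 0 1) k"
    unfolding k_def S
    by (rule continuous_on_cases[OF clos clos])
      (use k3 k\<^sub>2 \<phi> \<theta> in \<open>auto simp: hopf_lift_def E_def H_def\<close>)
  then have "hopf_lift (sphere 0 1) f k"
    using k3 k\<^sub>2 unfolding hopf_lift_def by (auto simp: k_def H_def)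
  then show thesis by (rule that)
qed

text \<open>Right multiplication by \<open>j\<close> turns a lift of \<open>f\<close> into a lift of \<open>- f\<close>, so \<open>k (T x)\<close> and \<open>k x j\<close>
  lift the same map and differ by a phase \<open>\<theta>\<close>. Applying this twice gives
  \<open>j exp (i \<theta> (x)) j exp (i \<theta> (T x))\<close>; moving \<open>j\<close> across the first phase inverts it, and \<open>j\<^sup>2 = -1\<close>
  contributes \<open>\<pi>\<close>.\<close>

lemma hopf_lift_odd_square:
  fixes X :: "'a::real_normed_vector set"
  assumes X: "Borsukian X" and k: "hopf_lift X f k"
    and T: "continuous_on X T" "T \<in> X \<rightarrow> X" "\<And>x. x \<in> X \<Longrightarrow> f (T x) = - f x"
  obtains \<theta> where "continuous_on X \<theta>" "\<And>x. x \<in> X \<Longrightarrow> k (T (T x)) = k x \<odot> cis_i (\<theta> (T x) - \<theta> x + pi)"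
proof -
  have kT: "hopf_lift X (\<lambda>x. f (T x)) (\<lambda>x. k (T x))" by (rule hopf_lift_compose[OF k T(1,2)])
  have kj: "hopf_lift X (\<lambda>x. f (T x)) (\<lambda>x. k x \<odot> qj)"
    unfolding hopf_lift_def
  proof (intro conjI ballI)
    show "continuous_on X (\<lambda>x. k x \<odot> qj)" using k by (auto simp: hopf_lift_def intro!: continuous_intros)
    fix x assume x: "x \<in> X"
    show "norm (k x \<odot> qj) = 1" using k x by (simp add: hopf_lift_def norm_qmul norm_Pair)
    have "(0::real, f (T x)) = - (0, f x)" using T(3)[OF x] by simp
    then have "(0, f (T x)) \<odot> (k x \<odot> qj) = - ((0, f x) \<odot> k x \<odot> qj)"
      by (simp only: qmul.minus_left qmul_assoc)
    also have "(0, f x) \<odot> k x = k x \<odot> qi" using k x by (simp add: hopf_lift_def)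
    finally show "(0, f (T x)) \<odot> (k x \<odot> qj) = k x \<odot> qj \<odot> qi"
      by (simp add: qmul_assoc qi_qj qmul.minus_right)
  qed
  obtain \<theta> where \<theta>: "continuous_on X \<theta>" "\<And>x. x \<in> X \<Longrightarrow> k (T x) = k x \<odot> qj \<odot> cis_i (\<theta> x)"
    using hopf_lift_phase[OF X kj kT] by blast
  have "k (T (T x)) = k x \<odot> cis_i (\<theta> (T x) - \<theta> x + pi)" if x: "x \<in> X" for x
  proof -
    have "T x \<in> X" using T(2) x by auto
    then have "k (T (T x)) = k x \<odot> (qj \<odot> (cis_i (\<theta> x) \<odot> qj) \<odot> cis_i (\<theta> (T x)))"
      by (simp add: \<theta>(2) x qmul_assoc)
    also have "qj \<odot> (cis_i (\<theta> x) \<odot> qj) = qj \<odot> qj \<odot> cis_i (- \<theta> x)"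
      by (simp add: cis_i_qj qmul_assoc)
    also have "\<dots> = cis_i (pi - \<theta> x)"
      using cis_i_add[of pi "- \<theta> x"] by (simp add: pure_unit_square cis_i_pi)
    finally show ?thesis by (simp add: algebra_simps flip: cis_i_add)
  qed
  with \<theta>(1) show thesis by (rule that)
qed

lemma cis_i_one_constant:
  assumes "connected X" "continuous_on X u" "\<And>x. x \<in> X \<Longrightarrow> cis_i (u x) = (1, 0)"
  obtains n :: int where "\<And>x. x \<in> X \<Longrightarrow> u x = 2 * pi * n"
proof -
  have n: "\<exists>n::int. u x = 2 * pi * n" if "x \<in> X" for x
    using assms(3)[OF that] cis_i_eq_iff[of "u x" 0] by (simp add: cis_i_zero)
  have "u constant_on X"
  proof (rule continuous_discrete_range_constant[OF assms(1,2)])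
    fix x assume x: "x \<in> X"
    have "2 * pi \<le> norm (u y - u x)" if y: "y \<in> X" "u y \<noteq> u x" for y
    proof -
      obtain m m' :: int where m: "u x = 2 * pi * m" "u y = 2 * pi * m'" using n x y by metis
      then have "m \<noteq> m'" using y by auto
      then have "1 \<le> \<bar>real_of_int m' - real_of_int m\<bar>" by linarith
      then have "2 * pi * 1 \<le> 2 * pi * \<bar>real_of_int m' - real_of_int m\<bar>" by (intro mult_left_mono) auto
      also have "\<dots> = norm (u y - u x)" by (simp add: m abs_mult flip: right_diff_distrib)
      finally show ?thesis by simp
    qed
    then show "\<exists>e>0. \<forall>y. y \<in> X \<and> u y \<noteq> u x \<longrightarrow> e \<le> norm (u y - u x)"
      by (intro exI[of _ "2 * pi"]) auto
  qed
  then show thesis using n that by (metis constant_on_def)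
qed

text \<open>Write \<open>N\<close> for the involution \<open>C\<^sup>2 = G\<^sup>4\<close>. Both maps determine a real phase of \<open>k (N x)\<close> relative to
  \<open>k x\<close>, namely

    \<open>\<alpha> x = \<theta> (C x) - \<theta> x + \<pi>\<close>

    \<open>\<beta> x = \<phi> (G\<^sup>3 x) - \<phi> (G\<^sup>2 x) + \<phi> (G x) - \<phi> x + 2 \<pi>\<close>.

  As \<open>N\<close> is an involution, \<open>\<alpha> x + \<alpha> (N x)\<close> is a multiple of \<open>2 \<pi>\<close>, hence constant. Its
  part without \<open>\<pi>\<close> changes sign when \<open>x\<close> is replaced by \<open>C x\<close>, so it is zero and the constant
  is \<open>2 \<pi>\<close>. In the same way \<open>\<beta> x + \<beta> (N x) = 4 \<pi>\<close>. But \<open>\<alpha> - \<beta>\<close> is a constant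
  multiple of \<open>2 \<pi>\<close>, so the two sums differ by a multiple of \<open>4 \<pi>\<close>: a contradiction.\<close>

lemma no_lift_odd_under_roots:
  fixes X :: "'a::real_normed_vector set"
  assumes X: "Borsukian X" "connected X" "X \<noteq> {}" and k: "hopf_lift X f k"
    and C: "continuous_on X C" "C \<in> X \<rightarrow> X" "\<And>x. x \<in> X \<Longrightarrow> f (C x) = - f x"
    and G: "continuous_on X G" "G \<in> X \<rightarrow> X" "\<And>x. x \<in> X \<Longrightarrow> f (G x) = - f x"
    and CG: "\<And>x. x \<in> X \<Longrightarrow> C (C x) = G (G (G (G x)))"
    and inv: "\<And>x. x \<in> X \<Longrightarrow> C (C (C (C x))) = x"
  shows False
proof -
  obtain \<theta> where \<theta>: "continuous_on X \<theta>" "\<And>x. x \<in> X \<Longrightarrow> k (C (C x)) = k x \<odot> cis_i (\<theta> (C x) - \<theta> x + pi)"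
    using hopf_lift_odd_square[OF X(1) k C] by metis
  obtain \<phi> where \<phi>: "continuous_on X \<phi>" "\<And>x. x \<in> X \<Longrightarrow> k (G (G x)) = k x \<odot> cis_i (\<phi> (G x) - \<phi> x + pi)"
    using hopf_lift_odd_square[OF X(1) k G] by metis
  define \<alpha> where "\<alpha> x = \<theta> (C x) - \<theta> x + pi" for x
  define \<beta> where "\<beta> x = \<phi> (G (G (G x))) - \<phi> (G (G x)) + \<phi> (G x) - \<phi> x + 2 * pi" for x
  have CX: "C x \<in> X" and GX: "G x \<in> X" if "x \<in> X" for x using C(2) G(2) that by auto
  have compC: "continuous_on X (\<lambda>x. h (C x))" if "continuous_on X h" for h :: "'a \<Rightarrow> real"
    using continuous_on_compose2[OF that C(1)] CX by auto
  have compG: "continuous_on X (\<lambda>x. h (G x))" if "continuous_on X h" for h :: "'a \<Rightarrow> real"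
    using continuous_on_compose2[OF that G(1)] GX by auto
  have c\<alpha>: "continuous_on X \<alpha>" unfolding \<alpha>_def by (intro continuous_intros compC \<theta>)
  have c\<beta>: "continuous_on X \<beta>" unfolding \<beta>_def by (intro continuous_intros compG \<phi>)
  have k\<alpha>: "k (C (C x)) = k x \<odot> cis_i (\<alpha> x)" if "x \<in> X" for x using \<theta>(2) that by (simp add: \<alpha>_def)
  have k\<beta>: "k (C (C x)) = k x \<odot> cis_i (\<beta> x)" if "x \<in> X" for x
  proof -
    have "k (C (C x)) = k x \<odot> (cis_i (\<phi> (G x) - \<phi> x + pi) \<odot> cis_i (\<phi> (G (G (G x))) - \<phi> (G (G x)) + pi))"
      using that by (simp add: CG \<phi>(2) GX qmul_assoc)
    then show ?thesis by (simp add: \<beta>_def algebra_simps flip: cis_i_add)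
  qed
  have cancel: "d = d'" if "x \<in> X" "k x \<odot> d = k x \<odot> d'" for x d d'
  proof -
    have n: "norm (k x) = 1" using k that by (simp add: hopf_lift_def)
    have "qconj (k x) \<odot> (k x \<odot> d) = qconj (k x) \<odot> (k x \<odot> d')" using that(2) by simp
    then show ?thesis by (simp add: n qmul_qconj_unit flip: qmul_assoc)
  qed
  have round: "cis_i (u x + u (C (C x))) = (1, 0)"
    if x: "x \<in> X" and u: "\<And>x. x \<in> X \<Longrightarrow> k (C (C x)) = k x \<odot> cis_i (u x)" for x u
  proof (rule cancel[OF x])
    have "k x \<odot> (1, 0) = k (C (C (C (C x))))" using inv x by simp
    also have "\<dots> = k x \<odot> (cis_i (u x) \<odot> cis_i (u (C (C x))))"
      using u x CX by (simp add: qmul_assoc)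
    finally show "k x \<odot> cis_i (u x + u (C (C x))) = k x \<odot> (1, 0)" by (simp add: cis_i_add)
  qed
  obtain m :: int where m: "\<And>x. x \<in> X \<Longrightarrow> \<alpha> x + \<alpha> (C (C x)) = 2 * pi * m"
    by (rule cis_i_one_constant[OF X(2), of "\<lambda>x. \<alpha> x + \<alpha> (C (C x))"])
      (auto intro!: continuous_on_add compC c\<alpha> round k\<alpha>)
  obtain n :: int where n: "\<And>x. x \<in> X \<Longrightarrow> \<beta> x + \<beta> (C (C x)) = 2 * pi * n"
    by (rule cis_i_one_constant[OF X(2), of "\<lambda>x. \<beta> x + \<beta> (C (C x))"])
      (auto intro!: continuous_on_add compC c\<beta> round k\<beta>)
  have "cis_i (\<alpha> x - \<beta> x) = (1, 0)" if "x \<in> X" for x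
  proof -
    have "cis_i (\<alpha> x) = cis_i (\<beta> x)"
      by (rule cancel[OF that]) (metis k\<alpha> k\<beta> that)
    then have "cis_i (\<alpha> x + - \<beta> x) = cis_i (\<beta> x + - \<beta> x)"
      by (simp only: cis_i_add)
    then show ?thesis by (simp add: cis_i_zero)
  qed
  then obtain l :: int where l: "\<And>x. x \<in> X \<Longrightarrow> \<alpha> x - \<beta> x = 2 * pi * l"
    using cis_i_one_constant[OF X(2), of "\<lambda>x. \<alpha> x - \<beta> x"] c\<alpha> c\<beta> continuous_on_diff by blast
  obtain x where x: "x \<in> X" using X(3) by auto
  have "\<alpha> x + \<alpha> (C (C x)) = 2 * pi"
  proof -
    have "\<alpha> (C x) + \<alpha> (C (C (C x))) = 2 * pi * m" using m CX x by blast
    then show ?thesis using m[OF x] by (simp only: \<alpha>_def inv[OF x])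
  qed
  moreover have "\<beta> x + \<beta> (C (C x)) = 4 * pi"
  proof -
    \<comment> \<open>Around the eight-point orbit of \<open>G\<close>, the alternating sum of \<open>\<phi>\<close> changes sign under a shift by
      one step.\<close>
    let ?G = "\<lambda>i. (G ^^ i) x"
    have GX': "?G i \<in> X" for i by (induction i) (auto simp: x GX)
    have C2: "C (C (?G i)) = ?G (i + 4)" for i using CG[OF GX', of i] by (simp add: numeral_eq_Suc)
    have G8: "?G 8 = x" using inv[OF x] C2[of 0] C2[of 4] by simp
    have \<beta>: "\<beta> (?G i) = \<phi> (?G (i + 3)) - \<phi> (?G (i + 2)) + \<phi> (?G (i + 1)) - \<phi> (?G i) + 2 * pi" for i
      by (simp add: \<beta>_def numeral_eq_Suc)
    have "\<beta> (?G i) + \<beta> (?G (i + 4)) = 2 * pi * n" for i using n[OF GX'] C2 by simp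
    from this[of 0] this[of 1] have "\<beta> (?G 0) + \<beta> (?G 4) = \<beta> (?G 1) + \<beta> (?G 5)"
      by (simp del: funpow.simps)
    then show ?thesis
      using G8 C2[of 0] \<beta>[of 0] \<beta>[of 1] \<beta>[of 4] \<beta>[of 5] by (simp add: numeral_eq_Suc)
  qed
  ultimately have "pi * (- 1) = pi * (2 * real_of_int l)" using l[OF x] l[OF CX[OF CX[OF x]]] by argo
  then have "- 1 = 2 * real_of_int l" by (simp only: mult_left_cancel[OF pi_neq_zero])
  then have "- 1 = 2 * l" by linarith
  then show False by presburger
qed

text \<open>Right multiplication by \<open>c\<close> is a square root of the antipodal map, and right multiplication by
  \<open>g\<close> is a fourth root of it.\<close>

lemma no_odd_map_sphere:
  fixes f :: "quat \<Rightarrow> real ^ 3"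
  assumes f: "continuous_on (sphere 0 1) f" "\<And>q. q \<in> sphere 0 1 \<Longrightarrow> norm (f q) = 1"
    and c: "norm c = 1" "c \<odot> c = (-1, 0)" "\<And>q. q \<in> sphere 0 1 \<Longrightarrow> f (q \<odot> c) = - f q"
    and g: "norm g = 1" "g \<odot> g \<odot> g \<odot> g = (-1, 0)" "\<And>q. q \<in> sphere 0 1 \<Longrightarrow> f (q \<odot> g) = - f q"
  shows False
proof -
  obtain k where k: "hopf_lift (sphere 0 1) f k" using hopf_lift_sphere[OF f] .
  show False
  proof (rule no_lift_odd_under_roots[OF _ _ _ k, of "\<lambda>q. q \<odot> c" "\<lambda>q. q \<odot> g"])
    show "Borsukian (sphere (0::quat) 1)" by (rule Borsukian_sphere) simp
    show "connected (sphere (0::quat) 1)" by (rule connected_sphere) simp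
    fix q :: quat assume "q \<in> sphere 0 1"
    show "q \<odot> c \<odot> c = q \<odot> g \<odot> g \<odot> g \<odot> g"
      using c(2) g(2) by (simp add: qmul_assoc)
    show "q \<odot> c \<odot> c \<odot> c \<odot> c = q"
      using c(2) by (simp add: qmul_assoc qmul.minus_right)
  qed (auto intro!: continuous_intros simp: norm_qmul c g)
qed

section \<open>Unit quaternions as rotations\<close>

text \<open>For a unit quaternion this is conjugation, and the assignment is the double cover of \<open>SO(3)\<close>.\<close>

definition rot :: "quat \<Rightarrow> real ^ 3 ^ 3" where
  "rot q = matrix (\<lambda>v. snd (q \<odot> (0, v) \<odot> qconj q))"

lemma rot_vec: "rot q *v v = snd (q \<odot> (0, v) \<odot> qconj q)"
proof -
  have "linear (\<lambda>v. snd (q \<odot> (0, v) \<odot> qconj q))"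
  proof (rule linearI)
    show "snd (q \<odot> (0, x + y) \<odot> qconj q) = snd (q \<odot> (0, x) \<odot> qconj q) + snd (q \<odot> (0, y) \<odot> qconj q)" for x y
      using qmul.add_right[of q "(0, x)" "(0, y)"] by (simp add: qmul.add_left)
    show "snd (q \<odot> (0, r *\<^sub>R x) \<odot> qconj q) = r *\<^sub>R snd (q \<odot> (0, x) \<odot> qconj q)" for r x
      using qmul.scaleR_right[of q r "(0, x)"] by (simp add: qmul.scaleR_left)
  qed
  then show ?thesis by (simp add: rot_def matrix_works)
qed

lemma rot_pure: "q \<odot> (0, v) \<odot> qconj q = (0, rot q *v v)"
  by (simp add: rot_vec prod_eq_iff)
    (simp add: qmul_def qconj_def inner_vec_def sum_3 cross_components algebra_simps)

lemma rot_qmul: "rot (p \<odot> q) = rot p ** rot q"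
proof -
  have "rot (p \<odot> q) *v v = (rot p ** rot q) *v v" for v
    by (simp add: rot_vec[of "p \<odot> q"] qconj_qmul rot_pure qmul_assoc flip: matrix_vector_mul_assoc)
      (simp add: rot_vec[of p] flip: rot_pure, simp add: qmul_assoc)
  then show ?thesis by (simp add: matrix_eq)
qed

lemma rot_pure_unit:
  assumes "norm u = 1"
  shows "rot (0, u) *v v = (2 * (u \<bullet> v)) *\<^sub>R u - v"
  using assms
  by (simp add: rot_vec qmul_def qconj_def Lagrange dot_square_norm cross_skew[of _ u]
      vec_eq_iff algebra_simps)

lemma uminus_matrix_vector_mult: "(- A) *v x = - (A *v x)" "A *v (- x) = - (A *v x)"
  for A :: "real ^ 'n ^ 'm"
  by (simp_all add: matrix_vector_mult_def vec_eq_iff sum_negf)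

lemma rot_neg_one: "rot (-1, 0) = mat 1"
  by (simp add: matrix_eq rot_vec) (simp add: qconj_def)

lemma continuous_on_rot: "continuous_on S rot"
proof -
  have "rot q = (\<chi> i j. snd (q \<odot> (0, axis j 1) \<odot> qconj q) $ i)" for q
    by (simp add: rot_def matrix_def)
  then show ?thesis by (auto intro!: continuous_intros)
qed

lemma norm_rot: "norm q = 1 \<Longrightarrow> norm (rot q *v v) = norm v"
  using arg_cong[OF rot_pure, of norm q v] by (simp add: norm_qmul)

text \<open>Conjugation by a unit quaternion preserves lengths, so its determinant is \<open>1\<close> or \<open>-1\<close>; the unit
  quaternions are connected and the identity has determinant \<open>1\<close>.\<close>

lemma rot_SO3:
  assumes "norm q = 1" shows "rot q \<in> SO3"
proof -
  have orth: "orthogonal_matrix (rot q)" if "norm q = 1" for q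
    using orthogonal_transformation_matrix[of "(*v) (rot q)"] norm_rot[OF that]
    by (simp add: orthogonal_transformation)
  have "(\<lambda>q. det (rot q)) constant_on sphere 0 1"
  proof (rule continuous_finite_range_constant)
    show "connected (sphere (0::quat) 1)" by (rule connected_sphere) simp
    show "continuous_on (sphere 0 1) (\<lambda>q. det (rot q))"
      unfolding det_3 by (intro continuous_intros continuous_on_rot)
    have "det (rot q) \<in> {1, -1}" if "q \<in> sphere 0 1" for q
      using det_orthogonal_matrix[OF orth] that by simp
    then have "(\<lambda>q. det (rot q)) ` sphere 0 1 \<subseteq> {1, -1}" by (rule image_subsetI)
    then show "finite ((\<lambda>q. det (rot q)) ` sphere 0 1)" by (rule finite_subset) simp
  qed
  then have "det (rot q) = det (rot (1, 0))"
    using assms unfolding constant_on_def by force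
  also have "rot (1, 0) = mat 1" by (simp add: matrix_eq rot_vec) (simp add: qconj_def)
  finally have "det (rot q) = 1" by simp
  then show ?thesis using orth assms by (simp add: SO3_def rotation_matrix_def)
qed

section \<open>The rotations attached to the tetrahedron\<close>

text \<open>For a transposition, \<open>tau\<close> is the reflection that exchanges the two vertices, and its negative is
  the half-turn about the direction of their difference. A pure unit quaternion represents the
  half-turn about itself.\<close>

lemma iota_transpose:
  assumes w: "inscribed_regular_tetrahedron w" and ij: "i \<noteq> j"
  defines "u \<equiv> (1 / norm (w i - w j)) *\<^sub>R (w i - w j)"
  shows "iota w (Transposition.transpose i j) = rot (0, u)"
proof -
  note ip = inner_w[OF w]
  let ?t = "Transposition.transpose i j"
  have p: "?t permutes UNIV" by (rule permutes_swap_id) auto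
  have nn: "(norm (w i - w j))\<^sup>2 = 8/3"
    using ij by (simp add: power2_norm_eq_inner inner_diff_left inner_diff_right ip)
  then have "norm (w i - w j) \<noteq> 0" by auto
  then have u1: "norm u = 1" by (simp add: u_def)
  have uw: "(2 * (u \<bullet> x)) *\<^sub>R u = (3/4 * ((w i - w j) \<bullet> x)) *\<^sub>R (w i - w j)" for x
    using nn by (simp add: u_def power2_eq_square divide_simps)
  have "rot (0, u) *v w l = iota w ?t *v w l" for l
  proof -
    have "iota w ?t *v w l = - w (?t l)"
      using ij by (simp add: iota_def sign_swap_id tau(2)[OF w p] uminus_matrix_vector_mult)
    then show ?thesis unfolding rot_pure_unit[OF u1] uw
      using ij by (auto simp: Transposition.transpose_def inner_diff_left ip)
  qed
  then show ?thesis using matrix_eq_on_w[OF w] by metis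
qed

text \<open>The Gram determinant. The scalar part of a product of three pure quaternions is minus their triple
  product, so its square depends on the inner products of the edges of the tetrahedron alone; the
  unspecified orientation of the tetrahedron affects only the sign.\<close>

lemma triple_product_square:
  fixes u v w :: "real ^ 3"
  shows "((cross3 u v) \<bullet> w)\<^sup>2 = (u \<bullet> u) * (v \<bullet> v) * (w \<bullet> w) + 2 * (u \<bullet> v) * (v \<bullet> w) * (u \<bullet> w)
    - (u \<bullet> u) * (v \<bullet> w)\<^sup>2 - (v \<bullet> v) * (u \<bullet> w)\<^sup>2 - (w \<bullet> w) * (u \<bullet> v)\<^sup>2"
  by (simp add: cross_components inner_vec_def sum_3) algebra

text \<open>Such a quaternion represents a quarter-turn: it is \<open>cos (\<pi>/4) + sin (\<pi>/4) n\<close> up to sign.\<close>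

lemma unit_power4:
  assumes "norm g = 1" "(fst g)\<^sup>2 = 1/2"
  shows "g \<odot> g \<odot> g \<odot> g = (-1, 0)"
proof -
  have v: "snd g \<bullet> snd g = 1/2"
    using assms by (simp add: norm_prod_def power2_norm_eq_inner)
  then have gg: "g \<odot> g = (0, (2 * fst g) *\<^sub>R snd g)"
    using assms(2) by (simp add: qmul_def prod_eq_iff power2_eq_square vec_eq_iff)
  have "(2 * fst g) * (2 * fst g) * (snd g \<bullet> snd g) = 1"
    using assms(2) unfolding v by (simp add: power2_eq_square)
  then have "(g \<odot> g) \<odot> (g \<odot> g) = (-1, 0)"
    unfolding gg by (simp add: qmul_def cross_mult_left cross_mult_right)
  then show ?thesis by (simp add: qmul_assoc)
qed

lemma matrix_inv_involution:
  fixes A :: "real ^ 'n ^ 'n"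
  assumes "A ** A = mat 1"
  shows "matrix_inv A = A"
proof -
  have "A ** matrix_inv A = mat 1"
    unfolding matrix_inv_def by (rule someI2[of _ A]) (use assms in auto)
  then have "A ** (A ** matrix_inv A) = A" by simp
  then show ?thesis by (simp add: matrix_mul_assoc assms)
qed

theorem proposition4:
  fixes w :: "4 \<Rightarrow> real ^ 3"
  assumes "inscribed_regular_tetrahedron w"
  shows "\<nexists>g. equivariant_map w g"
proof
  note w = assms
  note ip = inner_w[OF w]
  assume "\<exists>g. equivariant_map w g"
  then obtain g where g: "g \<in> SO3 \<rightarrow> sphere 0 1" "continuous_on SO3 g"
    and equi: "\<And>\<sigma> A. \<sigma> permutes UNIV \<Longrightarrow> A \<in> SO3 \<Longrightarrow> g (rho w \<sigma> A) = tau w \<sigma> *v g A"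
    unfolding equivariant_map_def by blast
  \<comment> \<open>Rotating the value of \<open>g\<close> by its argument turns equivariance into a symmetry up to sign,
    since \<open>tau\<close> and \<open>iota\<close> differ by the sign of the permutation.\<close>
  define f where "f q = rot q *v g (rot q)" for q
  have f1: "norm (f q) = 1" if "q \<in> sphere 0 1" for q
  proof -
    have "norm (f q) = norm (g (rot q))" using that by (simp add: f_def norm_rot)
    then show ?thesis using g(1) rot_SO3[of q] that by (auto simp: Pi_iff)
  qed
  have fcont: "continuous_on (sphere 0 1) f"
  proof -
    have "continuous_on (sphere 0 1) (\<lambda>q. g (rot q))"
      by (rule continuous_on_compose2[OF g(2) continuous_on_rot]) (auto simp: rot_SO3)
    then show ?thesis
      unfolding f_def matrix_vector_mult_def by (intro continuous_intros continuous_on_rot)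
  qed
  define u where "u i j = (0::real, (1 / norm (w i - w j)) *\<^sub>R (w i - w j))" for i j
  have u1: "norm (u i j) = 1" if "i \<noteq> j" for i j
    using that ip[of i i] ip[of i j] by (auto simp: u_def)
  have uu: "u i j \<odot> u i j = (-1, 0)" if "i \<noteq> j" for i j
    using u1[OF that] unfolding u_def by (intro pure_unit_square) simp
  have odd: "f (q \<odot> u i j) = - f q" if q: "q \<in> sphere 0 1" and ij: "i \<noteq> j" for q i j
  proof -
    let ?t = "Transposition.transpose i j"
    have p: "?t permutes UNIV" by (rule permutes_swap_id) auto
    have iota: "iota w ?t = rot (u i j)" using iota_transpose[OF w ij] by (simp add: u_def)
    have RR: "rot (u i j) ** rot (u i j) = mat 1"
      using uu[OF ij] by (simp add: rot_neg_one flip: rot_qmul)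
    then have "matrix_inv (rot (u i j)) = rot (u i j)" by (rule matrix_inv_involution)
    then have "rho w ?t (rot q) = rot (q \<odot> u i j)" by (simp add: rho_def iota rot_qmul)
    moreover have "tau w ?t = - rot (u i j)"
      using ij iota by (simp add: iota_def sign_swap_id minus_equation_iff[of _ "rot (u i j)"])
    ultimately have "g (rot (q \<odot> u i j)) = - rot (u i j) *v g (rot q)"
      using equi[OF p rot_SO3, of q] q by simp
    then have "f (q \<odot> u i j) = - ((rot q ** (rot (u i j) ** rot (u i j))) *v g (rot q))"
      by (simp add: f_def rot_qmul uminus_matrix_vector_mult flip: matrix_vector_mul_assoc)
    then show ?thesis by (simp add: RR f_def)
  qed
  \<comment> \<open>The product of three neighbouring transpositions is a four-cycle, whose rotation is a quarter-turn.\<close>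
  define a where "a = u 1 2 \<odot> u 2 3 \<odot> u 3 4"
  have a1: "norm a = 1" by (simp add: a_def norm_qmul u1)
  have a4: "a \<odot> a \<odot> a \<odot> a = (-1, 0)"
  proof (rule unit_power4[OF a1])
    have nn: "norm (w i - w j) = sqrt (8/3)" if "i \<noteq> j" for i j
      using that by (simp add: norm_eq_sqrt_inner inner_diff_left inner_diff_right ip)
    have inn: "snd (u i j) \<bullet> snd (u k l) = 3/8 * ((w i - w j) \<bullet> (w k - w l))"
      if "i \<noteq> j" "k \<noteq> l" for i j k l
      using that by (simp add: u_def nn)
    have "(fst a)\<^sup>2 = (cross3 (snd (u 1 2)) (snd (u 2 3)) \<bullet> snd (u 3 4))\<^sup>2"
      by (simp add: a_def qmul_def u_def)
    also have "\<dots> = 1/2"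
      unfolding triple_product_square
      by (simp add: inn inner_diff_left inner_diff_right ip power2_eq_square)
    finally show "(fst a)\<^sup>2 = 1/2" .
  qed
  show False
  proof (rule no_odd_map_sphere[OF fcont f1 u1 uu _ a1 a4])
    fix q :: quat assume q: "q \<in> sphere 0 1"
    have s: "q \<odot> u 1 2 \<in> sphere 0 1" "q \<odot> u 1 2 \<odot> u 2 3 \<in> sphere 0 1"
      using q by (simp_all add: norm_qmul u1)
    have "f (q \<odot> u 1 2 \<odot> u 2 3 \<odot> u 3 4) = - f q"
      using odd[OF q, of 1 2] odd[OF s(1), of 2 3] odd[OF s(2), of 3 4] by simp
    then show "f (q \<odot> a) = - f q" by (simp add: a_def qmul_assoc)
  qed (use odd[of _ 1 2] in auto)
qed

end
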